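(* Let $\phi:\mathbb{R}^d\to\mathbb{R}$ be continuously differentiable with safe set $\mathcal{S}=\{x\in\mathbb{R}^d:\phi(x)\ge 0\}$ (bounded) and boundary $\partial\mathcal{S}=\{x:\phi(x)=0\}$. Assume that there exists a state $x\in\mathcal{X}\cap\partial\mathcal{S}$ with $\nabla\phi(x)\neq 0$. Consider the system $\dot x_t^+=f(x_t)+g(x_t)u_t$ with $f$ unknown and $g$ known. Then, given the information $I(t,\delta)$ with $\delta=0$, no policy of the form $u_t=u(u_{nom},I(t,0))$ can ensure zero-violation safety. That is, for every such policy (chosen without knowledge of $f$) it is not the case that, for every admissible $f$ and every initial state $x_0\in\mathcal{S}\cap\mathcal{X}$, the closed-loop system yields a trajectory with $x_t\in\mathcal{S}$ for all $t\ge 0$.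
   Context: System: $\dot x_t^+=f(x_t)+g(x_t)u_t$ for $t\ge 0$, where $\dot x_t^+$ is the right-hand time derivative, $x_t\in\mathcal{X}\subseteq\mathbb{R}^d$ is the state and $u_t\in\mathcal{U}\subseteq\mathbb{R}^p$ is the control action. As a function of $t$, $u_t$ is right continuous, has left-hand limits, and has finitely many jumps in any finite time interval; $x_t$ is continuous in $t$. The maps $f:\mathcal{X}\to\mathbb{R}^d$ and $g:\mathcal{X}\to\mathbb{R}^{d\times p}$ are Lipschitz continuous and bounded on bounded sets; any such $f$ is called admissible. "Unknown $f$" means that the policy (including the nominal controller) must be fixed without knowledge of $f$: the same policy is used for all admissible $f$, and in particular the action $u_0$ at time $0$ does not depend on $f$. Information: $I(t,\delta)=\{(x_\tau,u_{\tau'}):\tau\in\mathcal{T}_x(t,\delta),\ \tau'\in\mathcal{T}_u(t,\delta)\}$ denotes the recorded state history over $\mathcal{T}_x(t,\delta)=\{\tau:\max\{0,t-\delta\}\le\tau\le t\}$ and action history over $\mathcal{T}_u(t,\delta)=\{\tau:\max\{0,t-\delta\}\le\tau<t\}$. For $\delta=0$ the information consists only of the current state $x_t$ (the action history is empty). Policy: $u_t=u(u_{nom},I(t,\delta))$ produces the action from $I(t,\delta)$ and the (bounded) action prescribed by a given nominal controller $u_{nom}$. Zero-violation safety means that the system is never unsafe: $\mathcal{S}$ is forward invariant for the closed loop, i.e. $x_0\in\mathcal{S}\Rightarrow x_t\in\mathcal{S}$ for all $t\ge0$ (for every realization, if the nominal controller is stochastic). *)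

theory Defs
  imports "HOL-Analysis.Analysis"
begin

(* Throughout, X is the state space, U the action set, and a matrix of type
   real^'p^'d has 'd rows and 'p columns.  Maps on X are total functions of
   which only the values on X are used. *)

definition safe_set :: "(real^'d \<Rightarrow> real) \<Rightarrow> (real^'d) set" where
  "safe_set \<phi> = {x. \<phi> x \<ge> 0}"

(* The zero set of \<phi>; it can be larger than the topological frontier of the safe set. *)
definition safe_boundary :: "(real^'d \<Rightarrow> real) \<Rightarrow> (real^'d) set" where
  "safe_boundary \<phi> = {x. \<phi> x = 0}"

definition admissible :: "(real^'d) set \<Rightarrow> (real^'d \<Rightarrow> 'b::real_normed_vector) \<Rightarrow> bool" where
  "admissible X f \<longleftrightarrow>
     (\<exists>L. L-lipschitz_on X f) \<and> (\<forall>B\<subseteq>X. bounded B \<longrightarrow> bounded (f ` B))"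

definition state_times :: "real \<Rightarrow> real \<Rightarrow> real set" where
  "state_times t \<delta> = {\<tau>. max 0 (t - \<delta>) \<le> \<tau> \<and> \<tau> \<le> t}"

definition action_times :: "real \<Rightarrow> real \<Rightarrow> real set" where
  "action_times t \<delta> = {\<tau>. max 0 (t - \<delta>) \<le> \<tau> \<and> \<tau> < t}"

(* Records of states and of actions, each entry tagged with its time relative to
   the present.  The two records are kept apart: a set of pairs (state, action)
   would be empty whenever the action record is. *)
type_synonym ('d, 'p) info = "(real \<times> (real^'d)) set \<times> (real \<times> (real^'p)) set"

definition information ::
  "(real \<Rightarrow> real^'d) \<Rightarrow> (real \<Rightarrow> real^'p) \<Rightarrow> real \<Rightarrow> real \<Rightarrow> ('d, 'p) info" where
  "information x u t \<delta> =
     ((\<lambda>\<tau>. (\<tau> - t, x \<tau>)) ` state_times t \<delta>, (\<lambda>\<tau>. (\<tau> - t, u \<tau>)) ` action_times t \<delta>)"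

lemma information_zero:
  assumes "t \<ge> 0"
  shows "information x u t 0 = ({(0, x t)}, {})"
proof -
  have "state_times t 0 = {t}" "action_times t 0 = {}"
    using assms by (auto simp: state_times_def action_times_def)
  then show ?thesis by (simp add: information_def)
qed

(* A policy turns the nominal action and the available information into an action. *)
type_synonym ('d, 'p) policy = "real^'p \<Rightarrow> ('d, 'p) info \<Rightarrow> real^'p"

definition policy_into :: "(real^'p) set \<Rightarrow> ('d::finite, 'p) policy \<Rightarrow> bool" where
  "policy_into U \<pi> \<longleftrightarrow> (\<forall>a I. \<pi> a I \<in> U)"

(* A nominal controller is any causal rule: the nominal action may depend on a
   realization of its randomness (of type 'w), on time, and on the whole past.
   Open-loop, state-feedback and deterministic controllers are special cases. *)
type_synonym ('w, 'd, 'p) nominal = "'w \<Rightarrow> real \<Rightarrow> ('d, 'p) info \<Rightarrow> real^'p"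

definition bounded_nominal :: "('w, 'd::finite, 'p::finite) nominal \<Rightarrow> bool" where
  "bounded_nominal unom \<longleftrightarrow> (\<exists>B. \<forall>\<omega> t I. norm (unom \<omega> t I) \<le> B)"

definition control_signal :: "(real^'p) set \<Rightarrow> (real \<Rightarrow> real^'p) \<Rightarrow> bool" where
  "control_signal U u \<longleftrightarrow>
     (\<forall>t\<ge>0. u t \<in> U) \<and>
     (\<forall>t\<ge>0. continuous (at_right t) u) \<and>
     (\<forall>t>0. \<exists>l. (u \<longlongrightarrow> l) (at_left t)) \<and>
     (\<forall>b. finite {t. 0 < t \<and> t \<le> b \<and> \<not> isCont u t})"

definition trajectory ::
  "(real^'d) set \<Rightarrow> (real^'p) set \<Rightarrow> (real^'d \<Rightarrow> real^'d) \<Rightarrow> (real^'d \<Rightarrow> real^'p^'d) \<Rightarrow>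
   (real \<Rightarrow> real^'d) \<Rightarrow> (real \<Rightarrow> real^'p) \<Rightarrow> bool" where
  "trajectory X U f g x u \<longleftrightarrow>
     control_signal U u \<and>
     continuous_on {0..} x \<and>
     (\<forall>t\<ge>0. x t \<in> X) \<and>
     (\<forall>t\<ge>0. (x has_vector_derivative (f (x t) + g (x t) *v u t)) (at_right t))"

(* At time t the nominal controller sees the history since time 0 (window length t),
   the policy only the window of length \<delta>. *)
definition closed_loop ::
  "(real^'d) set \<Rightarrow> (real^'p) set \<Rightarrow> (real^'d \<Rightarrow> real^'d) \<Rightarrow> (real^'d \<Rightarrow> real^'p^'d) \<Rightarrow>
   ('d, 'p) policy \<Rightarrow> ('w, 'd, 'p) nominal \<Rightarrow> real \<Rightarrow> 'w \<Rightarrow>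
   (real \<Rightarrow> real^'d) \<Rightarrow> (real \<Rightarrow> real^'p) \<Rightarrow> bool" where
  "closed_loop X U f g \<pi> unom \<delta> \<omega> x u \<longleftrightarrow>
     trajectory X U f g x u \<and>
     (\<forall>t\<ge>0. u t = \<pi> (unom \<omega> t (information x u t t)) (information x u t \<delta>))"

(* Existence of a safe trajectory is part of the definition.  No uniqueness is
   required, so the negation says that for some initial state and realization
   every closed-loop trajectory, if there is any, leaves S. *)
definition zero_violation_safe ::
  "(real^'d) set \<Rightarrow> (real^'p) set \<Rightarrow> (real^'d) set \<Rightarrow> (real^'d \<Rightarrow> real^'d) \<Rightarrow>
   (real^'d \<Rightarrow> real^'p^'d) \<Rightarrow> ('d, 'p) policy \<Rightarrow> ('w, 'd, 'p) nominal \<Rightarrow> real \<Rightarrow> bool" where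
  "zero_violation_safe X U S f g \<pi> unom \<delta> \<longleftrightarrow>
     (\<forall>x0\<in>S \<inter> X. \<forall>\<omega>. \<exists>x u.
        closed_loop X U f g \<pi> unom \<delta> \<omega> x u \<and> x 0 = x0 \<and> (\<forall>t\<ge>0. x t \<in> S))"

end

theory Submission
  imports Defs
begin

text \<open>At time \<open>0\<close> both the policy and the nominal controller see only the initial state, so the
  first action \<open>v\<close> at a regular boundary point \<open>x0\<close> does not depend on \<open>f\<close>.  The constant drift
  \<open>f = - g x0 v - \<nabla>\<phi> x0\<close> makes every closed-loop trajectory leave \<open>x0\<close> with velocity
  \<open>- \<nabla>\<phi> x0\<close>, along which \<open>\<phi>\<close> decreases strictly below \<open>0\<close>.\<close>

text \<open>A negative right derivative would push \<open>h\<close> strictly below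
  \<open>h a\<close> just after \<open>a\<close>. The minimum is one-sided, so only the sign of
  \<open>D\<close> is determined.\<close>

lemma has_right_derivative_nonneg_if_minimum:
  fixes h :: "real \<Rightarrow> real"
  assumes "(h has_real_derivative D) (at_right a)"
    and "\<And>t. t \<ge> a \<Longrightarrow> h a \<le> h t"
  shows "D \<ge> 0"
proof (rule ccontr)
  assume "\<not> D \<ge> 0"
  with assms(1) obtain e where "e > 0"
    and dec: "\<And>s. s > 0 \<Longrightarrow> a + s \<in> {a<..} \<Longrightarrow> s < e \<Longrightarrow> h (a + s) < h a"
    using has_real_derivative_neg_dec_right[of h D a "{a<..}"] by auto
  then have "h (a + e / 2) < h a" by auto
  moreover have "h a \<le> h (a + e / 2)" using \<open>e > 0\<close> by (intro assms(2)) simp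
  ultimately show False by simp
qed

text \<open>Only the inner map is one-sided: the gradient is a full derivative at
  \<open>x a\<close>, so the direction in which \<open>x\<close> leaves that point is irrelevant to
  the chain rule.\<close>

lemma GDERIV_compose_right_derivative:
  fixes x :: "real \<Rightarrow> 'a::real_inner"
  assumes "GDERIV \<phi> (x a) :> d" and "(x has_vector_derivative v) (at_right a)"
  shows "((\<lambda>t. \<phi> (x t)) has_real_derivative v \<bullet> d) (at_right a)"
proof -
  have "((\<lambda>t. \<phi> (x t)) has_derivative (\<lambda>s. (s *\<^sub>R v) \<bullet> d)) (at_right a)"
    using assms unfolding gderiv_def has_vector_derivative_def
    by (rule has_derivative_compose[rotated])
  then show ?thesis
    by (simp add: has_field_derivative_def mult_commute_abs)
qed

text \<open>Along a safe trajectory \<open>\<phi>\<close> stays nonnegative and starts at 0, so time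
  0 is a minimum of \<open>\<phi>\<close> along it: the initial velocity cannot point out of the
  safe set.\<close>

lemma safe_trajectory_boundary_velocity:
  assumes "GDERIV \<phi> (x 0) :> d" and "x 0 \<in> safe_boundary \<phi>"
    and "\<And>t. t \<ge> 0 \<Longrightarrow> x t \<in> safe_set \<phi>"
    and "trajectory X U f g x u"
  shows "(f (x 0) + g (x 0) *v u 0) \<bullet> d \<ge> 0"
proof (rule has_right_derivative_nonneg_if_minimum)
  show "((\<lambda>t. \<phi> (x t)) has_real_derivative (f (x 0) + g (x 0) *v u 0) \<bullet> d) (at_right 0)"
    using assms(1,4) by (intro GDERIV_compose_right_derivative) (auto simp: trajectory_def)
qed (use assms(2,3) in \<open>auto simp: safe_boundary_def safe_set_def\<close>)

text \<open>At time 0 the nominal controller's window, of length \<open>t\<close>, also shrinks to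
  the current state; hence \<open>f\<close> is absent from the right-hand side.\<close>

lemma closed_loop_initial_action:
  assumes "closed_loop X U f g \<pi> unom 0 \<omega> x u"
  shows "u 0 = \<pi> (unom \<omega> 0 ({(0, x 0)}, {})) ({(0, x 0)}, {})"
  using assms by (simp add: closed_loop_def information_zero)

lemma admissible_const: "admissible X (\<lambda>_. c)"
proof -
  have "0-lipschitz_on X (\<lambda>_. c)" by (simp add: lipschitz_on_def)
  moreover have "bounded ((\<lambda>_. c) ` B)" for B :: "(real^'d) set"
    by (rule bounded_subset[of "{c}"]) auto
  ultimately show ?thesis unfolding admissible_def by blast
qed

theorem mainTheorem1:
  fixes X :: "(real^'d) set" and U :: "(real^'p) set"
    and \<phi> :: "real^'d \<Rightarrow> real" and grad\<phi> :: "real^'d \<Rightarrow> real^'d"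
    and g :: "real^'d \<Rightarrow> real^'p^'d"
    and \<pi> :: "('d, 'p) policy" and unom :: "('w, 'd, 'p) nominal"
  assumes "\<And>x. GDERIV \<phi> x :> grad\<phi> x"
    and "continuous_on UNIV grad\<phi>"
    and "bounded (safe_set \<phi>)"
    and "\<exists>x \<in> X \<inter> safe_boundary \<phi>. grad\<phi> x \<noteq> 0"
    and "admissible X g"
    and "policy_into U \<pi>"
    and "bounded_nominal unom"
  shows "\<not> (\<forall>f. admissible X f \<longrightarrow>
               zero_violation_safe X U (safe_set \<phi>) f g \<pi> unom 0)"
proof
  assume safe: "\<forall>f. admissible X f \<longrightarrow> zero_violation_safe X U (safe_set \<phi>) f g \<pi> unom 0"
  obtain x0 where x0: "x0 \<in> X" "x0 \<in> safe_boundary \<phi>" "grad\<phi> x0 \<noteq> 0"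
    using assms(4) by blast
  \<comment> \<open>Safety is demanded for every realization, so an arbitrary one suffices.\<close>
  fix \<omega> :: 'w
  \<comment> \<open>Written without \<open>f\<close> or a trajectory, so \<open>f\<close> may be
    built from \<open>v\<close> without circularity.\<close>
  define v where "v = \<pi> (unom \<omega> 0 ({(0, x0)}, {})) ({(0, x0)}, {})"
  define f where "f = (\<lambda>_ :: real^'d. - (g x0 *v v) - grad\<phi> x0)"
  have "x0 \<in> safe_set \<phi> \<inter> X"
    using x0 by (simp add: safe_set_def safe_boundary_def)
  moreover have "zero_violation_safe X U (safe_set \<phi>) f g \<pi> unom 0"
    using safe by (simp add: f_def admissible_const)
  ultimately obtain x u where loop: "closed_loop X U f g \<pi> unom 0 \<omega> x u"
    and init: "x 0 = x0" and inv: "\<forall>t\<ge>0. x t \<in> safe_set \<phi>"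
    unfolding zero_violation_safe_def by blast
  have "u 0 = v"
    using closed_loop_initial_action[OF loop] by (simp add: init v_def)
  moreover have "(f (x 0) + g (x 0) *v u 0) \<bullet> grad\<phi> (x 0) \<ge> 0"
    using loop init inv x0(2) assms(1)
    by (intro safe_trajectory_boundary_velocity) (auto simp: closed_loop_def)
  ultimately have "grad\<phi> x0 \<bullet> grad\<phi> x0 \<le> 0"
    by (simp add: f_def init)
  with x0(3) show False by (metis inner_gt_zero_iff not_le)
qed

end
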